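(* Let $d\ge2$ and $1\le p\le\infty$. Then no nonempty open subspace of the metric space $W_p(\mathbf{R}^d)$ is a Busemann NPC space.
   Context: $W_p(\mathbf{R}^d)$ denotes the metric space $(\mathcal{P}_p(\mathbf{R}^d),W_p)$, where for $1\le p<\infty$, $\mathcal{P}_p(\mathbf{R}^d)$ is the set of Borel probability measures on $\mathbf{R}^d$ with finite $p$-th moment and $W_p$ is the $p$-Wasserstein distance for the Euclidean norm; for $p=\infty$, $\mathcal{P}_\infty(\mathbf{R}^d)$ is the set of Borel probability measures with bounded support and $W_\infty(\mu,\nu)=\inf_{\gamma}\,\gamma\text{-}\operatorname{ess\,sup}|x-y|$, the infimum over transport plans $\gamma$ of $\mu,\nu$. Geodesics are constant-speed minimizing geodesics parametrized by $[0,1]$, i.e. curves with $\operatorname{dist}(\gamma_s,\gamma_t)=|s-t|\operatorname{dist}(\gamma_0,\gamma_1)$; a subspace is geodesic if any two of its points are joined by a geodesic lying in it. A Busemann NPC (non-positively curved) space is a metric space which admits an open cover by geodesic subspaces such that, whenever $t\mapsto\gamma_t$ and $t\mapsto\eta_t$, $t\in[0,1]$, are geodesics in one of these subspaces with $\gamma_0=\eta_0$, the function $t\mapsto\operatorname{dist}(\gamma_t,\eta_t)$ is convex on $[0,1]$. An open subspace carries the restricted metric. *)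

theory Defs
  imports "HOL-Probability.Essential_Supremum" "HOL-Probability.Probability_Measure"
begin

section \<open>Busemann NPC spaces\<close>

text \<open>
  The following notions concern a metric space, given as a carrier set \<open>M\<close> with a distance
  function \<open>d\<close>; a subspace is a subset with the same \<open>d\<close>. The metric axioms themselves are
  not repeated in the definitions; they are a property of \<open>(M, d)\<close> in the intended uses.
  Openness is \<open>Metric_space.mopen\<close> with \<open>mball\<close> unfolded, because the locale constant has a
  usable characterization only after the metric axioms have been established.
\<close>

definition metric_open :: "'a set \<Rightarrow> ('a \<Rightarrow> 'a \<Rightarrow> real) \<Rightarrow> 'a set \<Rightarrow> bool" where
  "metric_open M d U \<longleftrightarrow> U \<subseteq> M \<and> (\<forall>x\<in>U. \<exists>r>0. {y \<in> M. d x y < r} \<subseteq> U)"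

definition geodesic_in :: "'a set \<Rightarrow> ('a \<Rightarrow> 'a \<Rightarrow> real) \<Rightarrow> (real \<Rightarrow> 'a) \<Rightarrow> bool" where
  "geodesic_in V d \<gamma> \<longleftrightarrow>
     (\<forall>t\<in>{0..1}. \<gamma> t \<in> V) \<and>
     (\<forall>s\<in>{0..1}. \<forall>t\<in>{0..1}. d (\<gamma> s) (\<gamma> t) = \<bar>s - t\<bar> * d (\<gamma> 0) (\<gamma> 1))"

definition geodesic_subspace :: "'a set \<Rightarrow> ('a \<Rightarrow> 'a \<Rightarrow> real) \<Rightarrow> bool" where
  "geodesic_subspace V d \<longleftrightarrow>
     (\<forall>x\<in>V. \<forall>y\<in>V. \<exists>\<gamma>. geodesic_in V d \<gamma> \<and> \<gamma> 0 = x \<and> \<gamma> 1 = y)"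

definition busemann_npc :: "'a set \<Rightarrow> ('a \<Rightarrow> 'a \<Rightarrow> real) \<Rightarrow> bool" where
  "busemann_npc M d \<longleftrightarrow>
     (\<exists>\<C>. \<Union>\<C> = M \<and>
        (\<forall>V\<in>\<C>. metric_open M d V \<and> geodesic_subspace V d \<and>
           (\<forall>\<gamma> \<eta>. geodesic_in V d \<gamma> \<longrightarrow> geodesic_in V d \<eta> \<longrightarrow> \<gamma> 0 = \<eta> 0 \<longrightarrow>
              convex_on {0..1} (\<lambda>t. d (\<gamma> t) (\<eta> t)))))"


section \<open>Wasserstein spaces\<close>

definition measure_support :: "'a::topological_space measure \<Rightarrow> 'a set" where
  "measure_support \<mu> = {x. \<forall>U. open U \<longrightarrow> x \<in> U \<longrightarrow> emeasure \<mu> U \<noteq> 0}"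

definition wasserstein_space :: "ennreal \<Rightarrow> 'a::euclidean_space measure set" where
  "wasserstein_space p =
     {\<mu>. sets \<mu> = sets borel \<and> prob_space \<mu> \<and>
          (if p = \<infinity> then bounded (measure_support \<mu>)
           else integrable \<mu> (\<lambda>x. norm x powr enn2real p))}"

definition transport_plans ::
    "'a::euclidean_space measure \<Rightarrow> 'a measure \<Rightarrow> ('a \<times> 'a) measure set" where
  "transport_plans \<mu> \<nu> =
     {\<gamma>. sets \<gamma> = sets borel \<and> distr \<gamma> borel fst = \<mu> \<and> distr \<gamma> borel snd = \<nu>}"

text \<open>
  The infima are taken in \<open>[0, \<infinity>]\<close>. On \<open>wasserstein_space p\<close> they are finite (use the
  product plan), so the conversion \<open>enn2real\<close> loses nothing there.
\<close>

definition wasserstein_dist ::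
    "ennreal \<Rightarrow> 'a::euclidean_space measure \<Rightarrow> 'a measure \<Rightarrow> real" where
  "wasserstein_dist p \<mu> \<nu> =
     (if p = \<infinity> then
        enn2real (INF \<gamma>\<in>transport_plans \<mu> \<nu>. esssup \<gamma> (\<lambda>(x, y). ennreal (dist x y)))
      else
        enn2real (INF \<gamma>\<in>transport_plans \<mu> \<nu>.
          \<integral>\<^sup>+ (x, y). ennreal (dist x y powr enn2real p) \<partial>\<gamma>) powr (1 / enn2real p))"

end

theory Submission
  imports Defs "HOL-Probability.Probability"
begin

text \<open>
  Geodesics are not locally unique. Given \<open>\<mu>\<close> in one of the covering sets, replace the mass of a small
  ball of positive measure around \<open>x\<^sub>0\<close> by two equal point masses at \<open>x\<^sub>0 \<plusminus> z\<close> with \<open>z\<close> short; this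
  moves mass only by twice the radius, so for all \<open>p\<close>, including \<open>\<infinity>\<close>, it stays in the covering set.
  For orthogonal \<open>u\<close>, \<open>v\<close> of equal length, moving \<open>z\<close> along the segment from \<open>u\<close> to \<open>v\<close> and along
  the one from \<open>u\<close> to \<open>-v\<close> gives two geodesics with the same endpoints but different midpoints.
  The distance between them vanishes at \<open>0\<close> and \<open>1\<close> and is positive at \<open>1/2\<close>, hence is not convex.
\<close>

section \<open>Upper and lower bounds for Wasserstein distances\<close>

lemma borel_measurable_fst_snd:
  fixes M :: "('a::second_countable_topology \<times> 'b::second_countable_topology) measure"
  assumes "sets M = sets borel"
  shows "fst \<in> borel_measurable M" "snd \<in> borel_measurable M"
  unfolding measurable_cong_sets[OF assms refl]
  by (auto intro!: borel_measurable_continuous_onI continuous_intros)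

lemma transport_plans_distr:
  fixes X Y :: "'b \<Rightarrow> 'a::euclidean_space"
  assumes [measurable]: "X \<in> borel_measurable M" "Y \<in> borel_measurable M"
  shows "distr M borel (\<lambda>\<omega>. (X \<omega>, Y \<omega>)) \<in> transport_plans (distr M borel X) (distr M borel Y)"
  unfolding transport_plans_def
  by (simp add: distr_distr comp_def borel_measurable_fst_snd[OF refl])

text \<open>Carrying mass \<open>m\<close> over distance \<open>L\<close> costs m^(1/p) * L, and
  just \<open>L\<close> when \<open>p = \<infinity>\<close>; this factor lets all exponents share
  one formula.\<close>

definition mass_factor :: "ennreal \<Rightarrow> real \<Rightarrow> real" where
  "mass_factor p m = (if p = \<infinity> then 1 else m powr (1 / enn2real p))"

lemma mass_factor_pos: "m > 0 \<Longrightarrow> mass_factor p m > 0"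
  by (simp add: mass_factor_def)

text \<open>This is the cost before the p-th root, so that both cases of the distance become bounds
  on one infimum over plans.\<close>

definition transport_cost :: "ennreal \<Rightarrow> ('a::euclidean_space \<times> 'a) measure \<Rightarrow> ennreal" where
  "transport_cost p \<gamma> =
     (if p = \<infinity> then esssup \<gamma> (\<lambda>(x, y). ennreal (dist x y))
      else \<integral>\<^sup>+ (x, y). ennreal (dist x y powr enn2real p) \<partial>\<gamma>)"

definition cost_value :: "ennreal \<Rightarrow> real \<Rightarrow> real \<Rightarrow> real" where
  "cost_value p m L = (if p = \<infinity> then L else m * L powr enn2real p)"

lemma wasserstein_dist_altdef:
  "wasserstein_dist p \<mu> \<nu> =
     (if p = \<infinity> then enn2real (INF \<gamma>\<in>transport_plans \<mu> \<nu>. transport_cost p \<gamma>)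
      else enn2real (INF \<gamma>\<in>transport_plans \<mu> \<nu>. transport_cost p \<gamma>) powr (1 / enn2real p))"
  unfolding wasserstein_dist_def transport_cost_def by simp

lemma enn2real_ge_1: "1 \<le> p \<Longrightarrow> p \<noteq> \<infinity> \<Longrightarrow> 1 \<le> enn2real p"
  by (cases p) (auto simp flip: ennreal_1)

lemma cost_value_root:
  assumes "1 \<le> p" "0 \<le> m" "0 \<le> L"
  shows "(if p = \<infinity> then cost_value p m L else cost_value p m L powr (1 / enn2real p))
           = mass_factor p m * L"
  using assms enn2real_ge_1[of p]
  by (auto simp: cost_value_def mass_factor_def powr_mult powr_powr)

text \<open>The joint law of \<open>X\<close> and \<open>Y\<close> is one competitor in the infimum.
  It moves mass only on \<open>S\<close>, and there by at most \<open>L\<close>.\<close>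

lemma INF_transport_cost_le:
  fixes X Y :: "'b \<Rightarrow> 'a::euclidean_space"
  assumes "1 \<le> p" "prob_space M"
    and X[measurable]: "X \<in> borel_measurable M" and Y[measurable]: "Y \<in> borel_measurable M"
    and S[measurable]: "S \<in> sets M" and L: "0 \<le> L"
    and bound: "\<And>\<omega>. \<omega> \<in> space M \<Longrightarrow> dist (X \<omega>) (Y \<omega>) \<le> indicator S \<omega> * L"
  shows "(INF \<gamma>\<in>transport_plans (distr M borel X) (distr M borel Y). transport_cost p \<gamma>)
           \<le> ennreal (cost_value p (measure M S) L)"
proof -
  interpret prob_space M by fact
  note borel_measurable_fst_snd[OF refl, measurable]
  let ?\<gamma> = "distr M borel (\<lambda>\<omega>. (X \<omega>, Y \<omega>))"
  have "transport_cost p ?\<gamma> \<le> ennreal (cost_value p (measure M S) L)"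
  proof (cases "p = \<infinity>")
    case True
    have [measurable]: "(\<lambda>(x, y). ennreal (dist x y)) \<in> borel_measurable (borel :: ('a \<times> 'a) measure)"
      unfolding split_beta' by measurable
    have "AE z in ?\<gamma>. (case z of (x, y) \<Rightarrow> ennreal (dist x y)) \<le> ennreal L"
    proof (subst AE_distr_iff)
      have "dist (X \<omega>) (Y \<omega>) \<le> L" if "\<omega> \<in> space M" for \<omega>
        using bound[OF that] L by (cases "\<omega> \<in> S") auto
      then show "AE \<omega> in M. (case (X \<omega>, Y \<omega>) of (x, y) \<Rightarrow> ennreal (dist x y)) \<le> ennreal L"
        by (auto intro: ennreal_leI)
    qed measurable
    then show ?thesis
      using True by (auto simp: transport_cost_def cost_value_def intro!: esssup_I)
  next
    case False
    with assms have q: "enn2real p \<ge> 1" by (simp add: enn2real_ge_1)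
    have "transport_cost p ?\<gamma> = (\<integral>\<^sup>+ \<omega>. ennreal (dist (X \<omega>) (Y \<omega>) powr enn2real p) \<partial>M)"
      using False by (simp add: transport_cost_def nn_integral_distr split_beta')
    also have "\<dots> \<le> (\<integral>\<^sup>+ \<omega>. ennreal (L powr enn2real p) * indicator S \<omega> \<partial>M)"
    proof (rule nn_integral_mono)
      fix \<omega> assume "\<omega> \<in> space M"
      from bound[OF this] show "ennreal (dist (X \<omega>) (Y \<omega>) powr enn2real p)
          \<le> ennreal (L powr enn2real p) * indicator S \<omega>"
        using q by (auto simp: indicator_def intro!: ennreal_leI powr_mono2 split: if_splits)
    qed
    also have "\<dots> = ennreal (measure M S * L powr enn2real p)"
      by (simp add: nn_integral_cmult_indicator emeasure_eq_measure ennreal_mult mult.commute[of "measure M S"])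
    finally show ?thesis using False by (simp add: cost_value_def)
  qed
  then show ?thesis
    using transport_plans_distr[OF X Y] by (rule INF_lower2[rotated])
qed

lemma wasserstein_dist_le:
  fixes X Y :: "'b \<Rightarrow> 'a::euclidean_space"
  assumes "1 \<le> p" "prob_space M"
    and "X \<in> borel_measurable M" "Y \<in> borel_measurable M"
    and "S \<in> sets M" "0 \<le> L"
    and "\<And>\<omega>. \<omega> \<in> space M \<Longrightarrow> dist (X \<omega>) (Y \<omega>) \<le> indicator S \<omega> * L"
  shows "wasserstein_dist p (distr M borel X) (distr M borel Y) \<le> mass_factor p (measure M S) * L"
proof -
  let ?I = "INF \<gamma>\<in>transport_plans (distr M borel X) (distr M borel Y). transport_cost p \<gamma>"
  \<comment> \<open>\<open>enn2real\<close> sends \<infinity> to 0, so its monotonicity rests on the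
    upper bound being finite.\<close>
  have "enn2real ?I \<le> enn2real (ennreal (cost_value p (measure M S) L))"
    by (rule enn2real_mono[OF INF_transport_cost_le]) (use assms in auto)
  moreover have "0 \<le> cost_value p (measure M S) L"
    using assms(6) by (simp add: cost_value_def)
  ultimately have "enn2real ?I \<le> cost_value p (measure M S) L" by simp
  moreover have "p \<noteq> \<infinity> \<Longrightarrow> 1 \<le> enn2real p" using assms(1) by (simp add: enn2real_ge_1)
  ultimately show ?thesis
    unfolding wasserstein_dist_altdef
    using cost_value_root[OF assms(1), of "measure M S" L] assms(6)
    by (auto split: if_splits intro: order_trans[OF powr_mono2])
qed

text \<open>The second marginal of any plan lives on \<open>C\<close>, so almost all mass that
  starts in \<open>A\<close> travels at least \<open>L\<close>. This mass is at least
  \<open>m\<close>, whatever the plan does elsewhere.\<close>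

lemma INF_transport_cost_ge:
  assumes "1 \<le> p" "0 < m" "0 \<le> L"
    and A[measurable]: "A \<in> sets borel" and C[measurable]: "C \<in> sets borel"
    and A_mass: "ennreal m \<le> emeasure \<mu> A" and C_full: "AE y in \<nu>. y \<in> C"
    and far: "\<And>x y. x \<in> A \<Longrightarrow> y \<in> C \<Longrightarrow> L \<le> dist x y"
  shows "ennreal (cost_value p m L) \<le> (INF \<gamma>\<in>transport_plans \<mu> \<nu>. transport_cost p \<gamma>)"
proof (rule INF_greatest)
  fix \<gamma> assume "\<gamma> \<in> transport_plans \<mu> \<nu>"
  then have sets[measurable_cong]: "sets \<gamma> = sets borel"
    and \<mu>: "\<mu> = distr \<gamma> borel fst" and \<nu>: "\<nu> = distr \<gamma> borel snd"
    by (auto simp: transport_plans_def)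
  have space: "space \<gamma> = UNIV" using sets_eq_imp_space_eq[OF sets] by simp
  have [measurable]: "fst \<in> \<gamma> \<rightarrow>\<^sub>M borel" "snd \<in> \<gamma> \<rightarrow>\<^sub>M borel"
    using borel_measurable_fst_snd[OF sets] by auto
  have SA[measurable]: "fst -` A \<in> sets \<gamma>"
    using measurable_sets[of fst \<gamma> borel A] by (simp add: space)
  have mA: "ennreal m \<le> emeasure \<gamma> (fst -` A)"
    using A_mass by (simp add: \<mu> emeasure_distr space)
  have AE_C: "AE z in \<gamma>. snd z \<in> C"
    using C_full unfolding \<nu> by (simp add: AE_distr_iff)
  have AE_far: "AE z in \<gamma>. fst z \<in> A \<longrightarrow> L \<le> dist (fst z) (snd z)"
    using AE_C by eventually_elim (auto intro: far)
  have dm: "(\<lambda>z. dist (fst z) (snd z)) \<in> borel_measurable \<gamma>"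
    by measurable
  show "ennreal (cost_value p m L) \<le> transport_cost p \<gamma>"
  proof (cases "p = \<infinity>")
    case True
    let ?e = "esssup \<gamma> (\<lambda>(x, y). ennreal (dist x y))"
    have "AE z in \<gamma>. (case z of (x, y) \<Rightarrow> ennreal (dist x y)) \<le> ?e"
      by (rule esssup_AE)
    \<comment> \<open>An essential supremum below \<open>L\<close> would make the part of the plan
      starting in \<open>A\<close> null, against \<open>0 < m\<close>.\<close>
    with AE_far have "AE z in \<gamma>. \<not> fst z \<in> A" if "?e < ennreal L"
    proof eventually_elim
      case (elim z)
      then show ?case using that ennreal_leI[of L "dist (fst z) (snd z)"]
        by (cases z) (auto simp: not_less[symmetric] dest: order.strict_trans2)
    qed
    then have "emeasure \<gamma> (fst -` A) = 0" if "?e < ennreal L"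
      using that by (subst (asm) AE_iff_measurable[OF SA]) (auto simp: space)
    with mA \<open>0 < m\<close> have "ennreal L \<le> ?e"
      by (metis ennreal_eq_0_iff le_zero_eq not_le)
    then show ?thesis using True by (simp add: transport_cost_def cost_value_def)
  next
    case False
    with assms have q: "enn2real p \<ge> 1" by (simp add: enn2real_ge_1)
    have "ennreal (cost_value p m L) = ennreal (L powr enn2real p) * ennreal m"
      using False \<open>0 < m\<close> by (simp add: cost_value_def ennreal_mult mult.commute)
    also have "\<dots> \<le> ennreal (L powr enn2real p) * emeasure \<gamma> (fst -` A)"
      by (rule mult_left_mono[OF mA]) simp
    also have "\<dots> = (\<integral>\<^sup>+ z. ennreal (L powr enn2real p) * indicator (fst -` A) z \<partial>\<gamma>)"
      by (simp add: nn_integral_cmult_indicator SA)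
    also have "\<dots> \<le> (\<integral>\<^sup>+ z. ennreal (dist (fst z) (snd z) powr enn2real p) \<partial>\<gamma>)"
      using AE_far
      by (intro nn_integral_mono_AE, eventually_elim)
         (use q \<open>0 \<le> L\<close> in \<open>auto simp: indicator_def intro!: ennreal_leI powr_mono2\<close>)
    also have "\<dots> = transport_cost p \<gamma>"
      using False by (simp add: transport_cost_def split_beta')
    finally show ?thesis .
  qed
qed

text \<open>The upper and lower bounds meet: \<open>X\<close> carries \<open>S\<close> into
  \<open>A\<close>, so \<open>A\<close> has at least the mass that the coupling moves, and
  \<open>Y\<close> never leaves \<open>C\<close>.\<close>

lemma wasserstein_dist_eq:
  fixes X Y :: "'b \<Rightarrow> 'a::euclidean_space"
  assumes "1 \<le> p" "prob_space M"
    and X[measurable]: "X \<in> borel_measurable M" and Y[measurable]: "Y \<in> borel_measurable M"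
    and S: "S \<in> sets M" "0 < measure M S" and L: "0 \<le> L"
    and bound: "\<And>\<omega>. \<omega> \<in> space M \<Longrightarrow> dist (X \<omega>) (Y \<omega>) \<le> indicator S \<omega> * L"
    and A[measurable]: "A \<in> sets borel" and C[measurable]: "C \<in> sets borel"
    and XA: "\<And>\<omega>. \<omega> \<in> S \<Longrightarrow> X \<omega> \<in> A"
    and YC: "\<And>\<omega>. \<omega> \<in> space M \<Longrightarrow> Y \<omega> \<in> C"
    and far: "\<And>x y. x \<in> A \<Longrightarrow> y \<in> C \<Longrightarrow> L \<le> dist x y"
  shows "wasserstein_dist p (distr M borel X) (distr M borel Y) = mass_factor p (measure M S) * L"
proof -
  interpret prob_space M by fact
  let ?I = "INF \<gamma>\<in>transport_plans (distr M borel X) (distr M borel Y). transport_cost p \<gamma>"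
  have "?I \<le> ennreal (cost_value p (measure M S) L)"
    by (rule INF_transport_cost_le) (use assms in auto)
  moreover have "ennreal (cost_value p (measure M S) L) \<le> ?I"
  proof (rule INF_transport_cost_ge[OF assms(1) S(2) L A C _ _ far])
    have "emeasure M S \<le> emeasure M (X -` A \<inter> space M)"
      using XA sets.sets_into_space[OF S(1)] by (intro emeasure_mono) auto
    then show "ennreal (measure M S) \<le> emeasure (distr M borel X) A"
      by (simp add: emeasure_distr emeasure_eq_measure)
    show "AE y in distr M borel Y. y \<in> C"
      by (subst AE_distr_iff) (auto intro!: AE_I2 YC)
  qed
  ultimately have "?I = ennreal (cost_value p (measure M S) L)" by (rule antisym)
  moreover have "0 \<le> cost_value p (measure M S) L"
    using L by (simp add: cost_value_def)
  ultimately show ?thesis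
    unfolding wasserstein_dist_altdef
    using cost_value_root[OF assms(1), of "measure M S" L] L by auto
qed

section \<open>Splitting the mass of a ball into two atoms\<close>

abbreviation coin :: "bool measure" where
  "coin \<equiv> measure_pmf (bernoulli_pmf (1/2))"

text \<open>Realizing the construction by random variables on one space for all \<open>z\<close>
  makes any two split measures come with a coupling.\<close>

definition split_ball :: "'a::euclidean_space \<Rightarrow> real \<Rightarrow> 'a \<Rightarrow> 'a \<times> bool \<Rightarrow> 'a" where
  "split_ball x\<^sub>0 \<delta> z = (\<lambda>(x, b). if x \<in> ball x\<^sub>0 \<delta> then (if b then x\<^sub>0 + z else x\<^sub>0 - z) else x)"

text \<open>The coin is needed because the restriction of \<open>\<mu>\<close> to the ball may be a single atom.\<close>

definition split_measure :: "'a::euclidean_space measure \<Rightarrow> 'a \<Rightarrow> real \<Rightarrow> 'a \<Rightarrow> 'a measure" where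
  "split_measure \<mu> x\<^sub>0 \<delta> z = distr (\<mu> \<Otimes>\<^sub>M coin) borel (split_ball x\<^sub>0 \<delta> z)"

locale ball_splitting = prob_space \<mu> for \<mu> :: "'a::euclidean_space measure" +
  fixes x\<^sub>0 :: 'a and \<delta> :: real
  assumes sets_\<mu> [measurable_cong]: "sets \<mu> = sets borel"
    and \<delta>_pos: "\<delta> > 0"
begin

lemma measurable_split_ball [measurable]: "split_ball x\<^sub>0 \<delta> z \<in> \<mu> \<Otimes>\<^sub>M coin \<rightarrow>\<^sub>M borel"
  unfolding split_ball_def mem_ball by measurable

lemma prob_space_coin: "prob_space (\<mu> \<Otimes>\<^sub>M coin)"
proof -
  interpret pair_prob_space \<mu> coin ..
  show ?thesis by (rule P.prob_space_axioms)
qed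

text \<open>This puts \<open>\<mu>\<close> on the same probability space as its split versions, so
  that the coupling bounds also compare \<open>\<mu>\<close> with them.\<close>

lemma distr_fst: "distr (\<mu> \<Otimes>\<^sub>M coin) borel fst = \<mu>"
proof -
  have "distr (\<mu> \<Otimes>\<^sub>M coin) borel fst = distr (\<mu> \<Otimes>\<^sub>M coin) \<mu> fst"
    by (rule distr_cong) (auto simp: sets_\<mu>)
  then show ?thesis using measure_pmf.distr_pair_fst[of \<mu>] by simp
qed

text \<open>A sign change of \<open>z\<close> swaps the two outcomes of a fair coin, which leaves
  the law unchanged. This is what makes geodesics towards \<open>v\<close> and \<open>-v\<close> end
  at the same measure.\<close>

lemma split_measure_uminus: "split_measure \<mu> x\<^sub>0 \<delta> (- z) = split_measure \<mu> x\<^sub>0 \<delta> z"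
proof -
  interpret pair_prob_space \<mu> coin ..
  have flip: "distr coin coin Not = coin"
  proof -
    have "map_pmf Not (bernoulli_pmf (1/2)) = bernoulli_pmf (1/2)"
    proof (rule pmf_eqI)
      fix b
      show "pmf (map_pmf Not (bernoulli_pmf (1/2))) b = pmf (bernoulli_pmf (1/2)) b"
        using pmf_map_inj'[of Not "bernoulli_pmf (1/2)" "\<not> b"] by (cases b) (auto simp: inj_def)
    qed
    then show ?thesis by (metis map_pmf_rep_eq distr_cong sets_measure_pmf_count_space)
  qed
  have "\<mu> \<Otimes>\<^sub>M coin = distr \<mu> \<mu> (\<lambda>x. x) \<Otimes>\<^sub>M distr coin coin Not"
    by (simp add: flip)
  also have "\<dots> = distr (\<mu> \<Otimes>\<^sub>M coin) (\<mu> \<Otimes>\<^sub>M coin) (\<lambda>(x, b). (x, \<not> b))"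
    by (subst pair_measure_distr) (auto simp: flip measure_pmf.sigma_finite_measure_axioms)
  finally have "split_measure \<mu> x\<^sub>0 \<delta> z =
      distr (distr (\<mu> \<Otimes>\<^sub>M coin) (\<mu> \<Otimes>\<^sub>M coin) (\<lambda>(x, b). (x, \<not> b))) borel (split_ball x\<^sub>0 \<delta> z)"
    by (simp add: split_measure_def)
  also have "\<dots> = split_measure \<mu> x\<^sub>0 \<delta> (- z)"
    unfolding split_measure_def
    by (subst distr_distr) (auto intro!: distr_cong simp: split_ball_def)
  finally show ?thesis ..
qed

text \<open>A point of the ball moves less than \<open>\<delta>\<close> to the center and then at
  most \<open>norm z\<close>; all others stay. Taking the whole space as moving set makes the mass
  factor 1 for every \<open>p\<close>.\<close>

lemma wasserstein_dist_split_measure_le: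
  assumes "1 \<le> p" "norm z \<le> \<delta>"
  shows "wasserstein_dist p \<mu> (split_measure \<mu> x\<^sub>0 \<delta> z) \<le> 2 * \<delta>"
proof -
  interpret c: prob_space "\<mu> \<Otimes>\<^sub>M coin" by (rule prob_space_coin)
  have "dist x (x\<^sub>0 + z) \<le> 2 * \<delta> \<and> dist x (x\<^sub>0 - z) \<le> 2 * \<delta>" if "dist x\<^sub>0 x < \<delta>" for x
    using that assms(2) dist_triangle[of x "x\<^sub>0 + z" x\<^sub>0] dist_triangle[of x "x\<^sub>0 - z" x\<^sub>0]
    by (auto simp: dist_norm norm_minus_commute)
  then have "wasserstein_dist p (distr (\<mu> \<Otimes>\<^sub>M coin) borel fst) (split_measure \<mu> x\<^sub>0 \<delta> z)
      \<le> mass_factor p (measure (\<mu> \<Otimes>\<^sub>M coin) (space (\<mu> \<Otimes>\<^sub>M coin))) * (2 * \<delta>)"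
    unfolding split_measure_def using assms \<delta>_pos
    by (intro wasserstein_dist_le prob_space_coin) (auto simp: split_ball_def)
  then show ?thesis by (simp add: distr_fst c.prob_space mass_factor_def split: if_splits)
qed

text \<open>No plan can do better than moving \<open>x\<^sub>0 \<plusminus> z\<close> to \<open>x\<^sub>0 \<plusminus> z'\<close>: since \<open>z \<bullet> z' \<ge> 0\<close> the point
  \<open>x\<^sub>0 + z'\<close> is the nearer one to \<open>x\<^sub>0 + z\<close>, and the untouched mass lies outside the ball.\<close>

lemma wasserstein_dist_split_measure:
  assumes "1 \<le> p" and pos: "0 < measure \<mu> (ball x\<^sub>0 \<delta>)"
    and z: "norm z \<le> \<delta> / 3" "norm z' \<le> \<delta> / 3" and inner: "0 \<le> z \<bullet> z'"
  shows "wasserstein_dist p (split_measure \<mu> x\<^sub>0 \<delta> z) (split_measure \<mu> x\<^sub>0 \<delta> z')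
           = mass_factor p (measure \<mu> (ball x\<^sub>0 \<delta>)) * dist z z'"
proof -
  let ?S = "ball x\<^sub>0 \<delta> \<times> (UNIV :: bool set)"
  have mS: "measure (\<mu> \<Otimes>\<^sub>M coin) ?S = measure \<mu> (ball x\<^sub>0 \<delta>)"
    
    using arg_cong[OF distr_fst, of "\<lambda>N. measure N (ball x\<^sub>0 \<delta>)"]
    by (subst (asm) measure_distr) (auto simp: space_pair_measure vimage_fst sets_eq_imp_space_eq[OF sets_\<mu>])
  have sum: "norm (z - z') \<le> norm (z + z')"
    using inner unfolding norm_le by (simp add: inner_simps inner_commute)
  have "wasserstein_dist p (split_measure \<mu> x\<^sub>0 \<delta> z) (split_measure \<mu> x\<^sub>0 \<delta> z')
           = mass_factor p (measure (\<mu> \<Otimes>\<^sub>M coin) ?S) * dist z z'"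
    unfolding split_measure_def
  \<comment> \<open>\<open>A\<close> holds the two atoms receiving the ball's mass, and
    \<open>C\<close> everything that the second splitting can hit.\<close>
  proof (rule wasserstein_dist_eq[OF assms(1) prob_space_coin,
        where A = "{x\<^sub>0 + z, x\<^sub>0 - z}" and C = "{x\<^sub>0 + z', x\<^sub>0 - z'} \<union> - ball x\<^sub>0 \<delta>"])
    fix x y assume "x \<in> {x\<^sub>0 + z, x\<^sub>0 - z}" "y \<in> {x\<^sub>0 + z', x\<^sub>0 - z'} \<union> - ball x\<^sub>0 \<delta>"
    then consider "x = x\<^sub>0 + z \<and> y = x\<^sub>0 + z' \<or> x = x\<^sub>0 - z \<and> y = x\<^sub>0 - z'"
      | "x = x\<^sub>0 + z \<and> y = x\<^sub>0 - z' \<or> x = x\<^sub>0 - z \<and> y = x\<^sub>0 + z'"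
      | "norm (x - x\<^sub>0) = norm z" "\<delta> \<le> dist x\<^sub>0 y"
      by (auto simp: not_less)
    then show "dist z z' \<le> dist x y"
    proof cases
      case 1
      then show ?thesis by (auto simp: dist_norm norm_minus_commute)
    next
      case 2
      then have "x - y = z + z' \<or> x - y = - (z + z')" by auto
      then have "dist x y = norm (z + z')" unfolding dist_norm by (metis norm_minus_cancel)
      then show ?thesis using sum by (simp add: dist_norm)
    next
      case 3
      \<comment> \<open>The bound \<open>\<delta> / 3\<close> is chosen for this case: a point
        outside the ball is at least \<open>\<delta> - \<delta> / 3\<close> away from
        \<open>x\<close>, and no more than that is needed.\<close>
      have "dist z z' \<le> 2 * \<delta> / 3"
        using z norm_triangle_ineq4[of z z'] by (simp add: dist_norm)
      then show ?thesis
        using 3 z dist_triangle[of x\<^sub>0 y x] by (simp add: dist_norm norm_minus_commute)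
    qed
  qed (auto simp: mS pos split_ball_def dist_norm norm_minus_commute sets_\<mu> split: if_splits)
  then show ?thesis by (simp add: mS)
qed

text \<open>Splitting either fixes a point or sends it into a fixed bounded set, so it affects
  neither boundedness of the support nor finiteness of the moment.\<close>

lemma split_measure_in_wasserstein_space:
  assumes "1 \<le> p" and "\<mu> \<in> wasserstein_space p"
  shows "split_measure \<mu> x\<^sub>0 \<delta> z \<in> wasserstein_space p"
proof -
  interpret c: prob_space "\<mu> \<Otimes>\<^sub>M coin" by (rule prob_space_coin)
  let ?f = "split_ball x\<^sub>0 \<delta> z"
  define K where "K = norm x\<^sub>0 + \<delta> + norm z"
  have K: "norm (?f \<omega>) \<le> K \<or> ?f \<omega> = fst \<omega>" for \<omega>
    using norm_triangle_ineq[of x\<^sub>0 z] norm_triangle_ineq4[of x\<^sub>0 z] \<delta>_pos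
    by (auto simp: split_ball_def K_def split: prod.splits)
  have K0: "0 \<le> K" using \<delta>_pos by (simp add: K_def)
  have "prob_space (split_measure \<mu> x\<^sub>0 \<delta> z)"
    unfolding split_measure_def by (rule c.prob_space_distr) simp
  moreover have "bounded (measure_support (split_measure \<mu> x\<^sub>0 \<delta> z))" if p: "p = \<infinity>"
  proof -
    have "x \<in> measure_support \<mu>"
      if x: "x \<in> measure_support (split_measure \<mu> x\<^sub>0 \<delta> z)" "x \<notin> cball 0 K" for x
      unfolding measure_support_def mem_Collect_eq
    proof (intro allI impI)
      fix W :: "'a set" assume W: "open W" "x \<in> W"
      \<comment> \<open>Away from \<open>cball 0 K\<close> only unmoved points arrive, so the split
        measure of \<open>?W\<close> is at most its \<open>\<mu>\<close>-measure.\<close>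
      let ?W = "W - cball 0 K"
      have o: "open ?W" using W by (intro open_Diff) auto
      then have "emeasure (split_measure \<mu> x\<^sub>0 \<delta> z) ?W \<noteq> 0"
        using x W by (auto simp: measure_support_def)
      moreover have "emeasure (split_measure \<mu> x\<^sub>0 \<delta> z) ?W \<le> emeasure (distr (\<mu> \<Otimes>\<^sub>M coin) borel fst) ?W"
      proof -
        have "split_ball x\<^sub>0 \<delta> z -` ?W \<inter> space (\<mu> \<Otimes>\<^sub>M coin) \<subseteq> fst -` ?W \<inter> space (\<mu> \<Otimes>\<^sub>M coin)"
        proof
          fix \<omega> assume "\<omega> \<in> split_ball x\<^sub>0 \<delta> z -` ?W \<inter> space (\<mu> \<Otimes>\<^sub>M coin)"
          with K[of \<omega>] show "\<omega> \<in> fst -` ?W \<inter> space (\<mu> \<Otimes>\<^sub>M coin)" by auto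
        qed
        moreover have [measurable]: "?W \<in> sets borel" using o by simp
        ultimately show ?thesis
          unfolding split_measure_def by (simp add: emeasure_distr emeasure_mono measurable_sets)
      qed
      moreover have "emeasure \<mu> ?W \<le> emeasure \<mu> W"
        using W by (intro emeasure_mono) (auto simp: sets_\<mu>)
      ultimately show "emeasure \<mu> W \<noteq> 0" by (auto simp: distr_fst)
    qed
    then have "measure_support (split_measure \<mu> x\<^sub>0 \<delta> z) \<subseteq> measure_support \<mu> \<union> cball 0 K"
      by blast
    moreover have "bounded (measure_support \<mu>)"
      using assms(2) p by (simp add: wasserstein_space_def)
    ultimately show ?thesis by (meson bounded_Un bounded_cball bounded_subset)
  qed
  moreover have "integrable (split_measure \<mu> x\<^sub>0 \<delta> z) (\<lambda>x. norm x powr enn2real p)" if p: "p \<noteq> \<infinity>"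
  proof -
    let ?q = "enn2real p"
    have q: "?q \<ge> 1" using assms(1) p by (rule enn2real_ge_1)
    have "integrable \<mu> (\<lambda>x. norm x powr ?q)"
      using assms(2) p by (simp add: wasserstein_space_def)
    then have "integrable (distr (\<mu> \<Otimes>\<^sub>M coin) borel fst) (\<lambda>x. norm x powr ?q)"
      by (simp add: distr_fst)
    then have "integrable (\<mu> \<Otimes>\<^sub>M coin) (\<lambda>\<omega>. norm (fst \<omega>) powr ?q)"
      by (subst (asm) integrable_distr_eq) auto
    then have int: "integrable (\<mu> \<Otimes>\<^sub>M coin) (\<lambda>\<omega>. K powr ?q + norm (fst \<omega>) powr ?q)"
      by simp
    have le: "norm (?f \<omega>) powr ?q \<le> K powr ?q + norm (fst \<omega>) powr ?q" for \<omega>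
      using K[of \<omega>]
    proof
      assume "norm (?f \<omega>) \<le> K"
      then have "norm (?f \<omega>) powr ?q \<le> K powr ?q" using q by (intro powr_mono2) auto
      then show ?thesis by (rule order_trans) simp
    qed simp
    have "integrable (\<mu> \<Otimes>\<^sub>M coin) (\<lambda>\<omega>. norm (?f \<omega>) powr ?q)"
      by (rule Bochner_Integration.integrable_bound[OF int])
         (use le K0 in \<open>auto intro!: AE_I2\<close>)
    then show ?thesis
      unfolding split_measure_def by (subst integrable_distr_eq) auto
  qed
  ultimately show ?thesis
    by (auto simp: wasserstein_space_def split_measure_def)
qed

text \<open>On short vectors with nonnegative inner products, \<open>split_measure\<close> scales
  distances by a constant. As \<open>u\<close> and \<open>w\<close> are orthogonal, any two points
  of the segment between them form such a pair, so the straight segment becomes a geodesic.\<close>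

lemma geodesic_in_split_measure:
  assumes "1 \<le> p" and pos: "0 < measure \<mu> (ball x\<^sub>0 \<delta>)"
    and uw: "norm u = 1" "norm w = 1" "u \<bullet> w = 0"
    and h: "0 < h" "h \<le> \<delta> / 3"
    and V: "\<And>z. norm z \<le> h \<Longrightarrow> split_measure \<mu> x\<^sub>0 \<delta> z \<in> V"
  shows "geodesic_in V (wasserstein_dist p)
           (\<lambda>t. split_measure \<mu> x\<^sub>0 \<delta> (h *\<^sub>R ((1 - t) *\<^sub>R u + t *\<^sub>R w)))"
proof -
  define e where "e t = h *\<^sub>R ((1 - t) *\<^sub>R u + t *\<^sub>R w)" for t
  have norm_e: "norm (e t) \<le> h" if "t \<in> {0..1}" for t
  proof -
    have "norm ((1 - t) *\<^sub>R u + t *\<^sub>R w) \<le> (1 - t) + t"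
      using that uw by (intro order_trans[OF norm_triangle_ineq]) auto
    then show ?thesis using h by (simp add: e_def)
  qed
  have inner_e: "0 \<le> e s \<bullet> e t" if "s \<in> {0..1}" "t \<in> {0..1}" for s t
  proof -
    have "u \<bullet> u = 1" "w \<bullet> w = 1" "w \<bullet> u = 0"
      using uw by (simp_all add: norm_eq_1 inner_commute)
    then have "e s \<bullet> e t = h * (h * ((1 - s) * (1 - t) + s * t))"
      using uw by (simp add: e_def inner_simps algebra_simps)
    then show ?thesis using that h by simp
  qed
  have dist_e: "dist (e s) (e t) = \<bar>s - t\<bar> * (h * norm (u - w))" for s t
  proof -
    have "e s - e t = (s - t) *\<^sub>R h *\<^sub>R (w - u)"
      by (simp add: e_def algebra_simps)
    then show ?thesis using h by (simp add: dist_norm norm_minus_commute abs_mult)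
  qed
  have W: "wasserstein_dist p (split_measure \<mu> x\<^sub>0 \<delta> (e s)) (split_measure \<mu> x\<^sub>0 \<delta> (e t))
      = mass_factor p (measure \<mu> (ball x\<^sub>0 \<delta>)) * (\<bar>s - t\<bar> * (h * norm (u - w)))"
    if "s \<in> {0..1}" "t \<in> {0..1}" for s t
    using wasserstein_dist_split_measure[OF assms(1) pos, of "e s" "e t"] h
      norm_e[OF that(1)] norm_e[OF that(2)] inner_e[OF that] by (simp add: dist_e)
  show ?thesis
    unfolding geodesic_in_def e_def[symmetric] using V norm_e by (simp add: W)
qed

end

section \<open>A ball of positive mass, and the contradiction\<close>

lemma ex_ball_measure_pos:
  fixes M :: "'a::euclidean_space measure"
  assumes "sets M = sets borel" and "\<delta> > 0" and "prob_space M"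
  shows "\<exists>x. 0 < measure M (ball x \<delta>)"
proof (rule ccontr)
  interpret prob_space M by fact
  assume "\<nexists>x. 0 < measure M (ball x \<delta>)"
  then have null: "ball x \<delta> \<in> null_sets M" for x
    using assms(1) by (auto simp: null_sets_def emeasure_eq_measure not_less measure_le_0_iff)
  \<comment> \<open>If all balls of radius \<open>\<delta>\<close> were null, countably many of them
    would still cover the space and give it total mass 0.\<close>
  obtain \<F> where \<F>: "\<F> \<subseteq> range (\<lambda>x::'a. ball x \<delta>)" "countable \<F>" "\<Union>\<F> = (\<Union>x. ball x \<delta>)"
    by (rule Lindelof[of "range (\<lambda>x::'a. ball x \<delta>)"]) auto
  have "(\<Union>x::'a. ball x \<delta>) = UNIV" using assms(2) by force
  moreover have "\<Union>\<F> \<in> null_sets M"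
    using \<F> null by (intro null_sets_UN'[of \<F> "\<lambda>x. x", simplified]) auto
  moreover have "space M = UNIV" using sets_eq_imp_space_eq[OF assms(1)] by simp
  ultimately show False using \<F>(3) emeasure_space_1 by (auto simp: null_sets_def)
qed

theorem theorem4p8:
  fixes p :: ennreal and U :: "(real ^ 'n) measure set"
  assumes "CARD('n) \<ge> 2" and "1 \<le> p"
    and "metric_open (wasserstein_space p) (wasserstein_dist p) U" and "U \<noteq> {}"
  shows "\<not> busemann_npc U (wasserstein_dist p)"
proof
  let ?W = "wasserstein_dist p :: (real ^ 'n) measure \<Rightarrow> _"
  assume "busemann_npc U ?W"
  then obtain \<C> where \<C>: "\<Union>\<C> = U" and open_\<C>: "\<And>V. V \<in> \<C> \<Longrightarrow> metric_open U ?W V"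
    and convex_\<C>: "\<And>V \<gamma> \<eta>. V \<in> \<C> \<Longrightarrow> geodesic_in V ?W \<gamma> \<Longrightarrow> geodesic_in V ?W \<eta> \<Longrightarrow> \<gamma> 0 = \<eta> 0 \<Longrightarrow>
              convex_on {0..1} (\<lambda>t. ?W (\<gamma> t) (\<eta> t))"
    unfolding busemann_npc_def by blast
  obtain \<mu> where \<mu>U: "\<mu> \<in> U" using \<open>U \<noteq> {}\<close> by auto
  then obtain V where V: "V \<in> \<C>" "\<mu> \<in> V" using \<C> by auto
  obtain r1 where r1: "r1 > 0" "{\<nu> \<in> U. ?W \<mu> \<nu> < r1} \<subseteq> V"
    using open_\<C>[OF V(1)] V(2) by (auto simp: metric_open_def)
  obtain r2 where r2: "r2 > 0" "{\<nu> \<in> wasserstein_space p. ?W \<mu> \<nu> < r2} \<subseteq> U"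
    using assms(3) \<mu>U by (auto simp: metric_open_def)
  have \<mu>: "\<mu> \<in> wasserstein_space p" using assms(3) \<mu>U by (auto simp: metric_open_def)
  \<comment> \<open>Splitting moves \<open>\<mu>\<close> by at most \<open>2 * \<delta>\<close>,
    which is below both radii: \<open>r2\<close> keeps the result in \<open>U\<close>, and
    \<open>r1\<close> then in \<open>V\<close>. The choice of \<open>h\<close> meets the length
    bound of the distance formula.\<close>
  define \<delta> where "\<delta> = min r1 r2 / 3"
  define h where "h = \<delta> / 3"
  have pos: "\<delta> > 0" "h > 0" using r1 r2 by (auto simp: \<delta>_def h_def)
  have sets_\<mu>: "sets \<mu> = sets borel" and "prob_space \<mu>"
    using \<mu> by (auto simp: wasserstein_space_def)
  obtain x\<^sub>0 where x0: "0 < measure \<mu> (ball x\<^sub>0 \<delta>)"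
    using ex_ball_measure_pos[OF sets_\<mu> pos(1) \<open>prob_space \<mu>\<close>] by auto
  interpret ball_splitting \<mu> x\<^sub>0 \<delta>
    by (intro ball_splitting.intro ball_splitting_axioms.intro \<open>prob_space \<mu>\<close>) (use sets_\<mu> pos in auto)
  let ?\<kappa> = "split_measure \<mu> x\<^sub>0 \<delta>"
  have in_V: "?\<kappa> z \<in> V" if "norm z \<le> h" for z
  proof -
    have "?W \<mu> (?\<kappa> z) \<le> 2 * \<delta>"
      using that pos by (intro wasserstein_dist_split_measure_le assms) (auto simp: h_def)
    also have "\<dots> < min r1 r2" using pos by (auto simp: \<delta>_def min_def)
    finally show ?thesis
      using split_measure_in_wasserstein_space[OF assms(2) \<mu>, of z] r1 r2 by auto
  qed
  \<comment> \<open>The dimension enters here: two distinct coordinates give orthogonal unit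
    vectors.\<close>
  have "\<not> card (UNIV :: 'n set) \<le> Suc 0" using assms(1) by simp
  then obtain i j :: 'n where ij: "i \<noteq> j" using card_le_Suc0_iff_eq[of "UNIV :: 'n set"] by auto
  define u v :: "real ^ 'n" where "u = axis i 1" and "v = axis j 1"
  have uv: "norm u = 1" "norm v = 1" "u \<bullet> v = 0"
    using ij by (auto simp: u_def v_def inner_axis_axis)
  define \<gamma> where "\<gamma> w t = ?\<kappa> (h *\<^sub>R ((1 - t) *\<^sub>R u + t *\<^sub>R w))" for w t
  have geo: "geodesic_in V ?W (\<gamma> w)" if "w \<in> {v, - v}" for w
    unfolding \<gamma>_def using that uv pos
    by (intro geodesic_in_split_measure assms x0 in_V) (auto simp: h_def)
  have "convex_on {0..1} (\<lambda>t. ?W (\<gamma> v t) (\<gamma> (- v) t))"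
    by (rule convex_\<C>[OF V(1) geo geo]) (auto simp: \<gamma>_def)
  \<comment> \<open>Convexity bounds the distance of the midpoints by the mean of the endpoint
    distances, and both of those will be 0.\<close>
  from convex_onD[OF this, of "1/2" 0 1]
  have "?W (\<gamma> v (1/2)) (\<gamma> (- v) (1/2)) \<le> (?W (\<gamma> v 0) (\<gamma> (- v) 0) + ?W (\<gamma> v 1) (\<gamma> (- v) 1)) / 2"
    by simp
  \<comment> \<open>Vanishing self-distance is the case of equal vectors in the distance formula, so
    no metric axioms are invoked.\<close>
  moreover have zero: "?W (?\<kappa> z) (?\<kappa> z) = 0" if "norm z \<le> h" for z
    using wasserstein_dist_split_measure[OF assms(2) x0, of z z] that by (simp add: h_def)
  moreover have "\<gamma> (- v) 0 = \<gamma> v 0" "\<gamma> (- v) 1 = \<gamma> v 1"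
    using split_measure_uminus[of "h *\<^sub>R v"] by (auto simp: \<gamma>_def)
  moreover have "?W (\<gamma> v (1/2)) (\<gamma> (- v) (1/2)) > 0"
  proof -
    \<comment> \<open>The midpoints come from multiples of \<open>u + v\<close> and
      \<open>u - v\<close>. These are orthogonal because \<open>u\<close> and \<open>v\<close> have
      equal length, so the exact distance formula applies, and they differ by
      \<open>h *\<^sub>R v\<close>.\<close>
    define z z' where "z = h *\<^sub>R ((1/2) *\<^sub>R u + (1/2) *\<^sub>R v)"
      and "z' = h *\<^sub>R ((1/2) *\<^sub>R u + (1/2) *\<^sub>R (- v))"
    have "u \<bullet> u = 1" "v \<bullet> v = 1" "v \<bullet> u = 0"
      using uv by (simp_all add: norm_eq_1 inner_commute)
    then have "z \<bullet> z' = 0"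
      using uv by (simp add: z_def z'_def inner_simps algebra_simps)
    moreover have "norm ((1/2) *\<^sub>R u + (1/2) *\<^sub>R w) \<le> 1" if "norm w = 1" for w
      using that uv by (intro order_trans[OF norm_triangle_ineq]) auto
    from this[of v] this[of "- v"] have "norm z \<le> \<delta> / 3" "norm z' \<le> \<delta> / 3"
      unfolding z_def z'_def using uv pos by (auto simp: h_def intro!: mult_left_le)
    ultimately have "?W (?\<kappa> z) (?\<kappa> z') = mass_factor p (measure \<mu> (ball x\<^sub>0 \<delta>)) * dist z z'"
      by (intro wasserstein_dist_split_measure assms x0) auto
    moreover have "z - z' = h *\<^sub>R v"
      by (simp add: z_def z'_def algebra_simps flip: scaleR_add_left)
    then have "dist z z' > 0" using pos uv by (simp add: dist_norm)
    ultimately show ?thesis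
      using mass_factor_pos[OF x0] by (simp add: \<gamma>_def z_def z'_def)
  qed
  moreover have "?W (\<gamma> v 0) (\<gamma> v 0) = 0" "?W (\<gamma> v 1) (\<gamma> v 1) = 0"
    using uv pos by (auto simp: \<gamma>_def intro!: zero)
  ultimately show False by simp
qed

end
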